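(* The Medvedev lattice is embeddable into the parallel Weihrauch lattice, restricted to total and continuous multi-valued functions on Baire space and $\boldsymbol{\emptyset}$, with an embedding that preserves least upper bounds and greatest lower bounds. That is, there is a map $\iota$ from the set of Medvedev degrees to the set $\widehat{\mathcal{W}}$ of parallel Weihrauch degrees such that: $a\leq_{\mathrm M}b\iff\iota(a)\leq_{\widehat{\mathrm W}}\iota(b)$ for all Medvedev degrees $a,b$; each value $\iota(a)$ is either the degree $\mathbf{0}$ of $\boldsymbol{\emptyset}$ or the parallel degree of some total continuous multi-valued function $f:\mathbb{N}^{\mathbb{N}}\rightrightarrows\mathbb{N}^{\mathbb{N}}$; and $\iota$ maps the least upper bound (greatest lower bound) of any two Medvedev degrees to the least upper bound (greatest lower bound) of their images in the parallel Weihrauch lattice.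
   Context: Medvedev reducibility for $\mathcal{A},\mathcal{B}\subseteq\mathbb{N}^{\mathbb{N}}$: $\mathcal{A}\leq_{\mathrm M}\mathcal{B}$ iff there is a computable partial $F:\subseteq\mathbb{N}^{\mathbb{N}}\to\mathbb{N}^{\mathbb{N}}$ with $\mathcal{B}\subseteq\mathrm{dom}(F)$ and $F(\mathcal{B})\subseteq\mathcal{A}$. The Medvedev lattice is the partially ordered set of equivalence classes (Medvedev degrees) of all subsets of $\mathbb{N}^{\mathbb{N}}$. A represented space $(X,\delta_X)$ is a set $X$ with a surjective partial map $\delta_X:\subseteq\mathbb{N}^{\mathbb{N}}\to X$; $x\in X$ is computable if it has a computable name. A multi-valued function $f:\subseteq X\rightrightarrows Y$ assigns to each $x$ a set $f(x)\subseteq Y$, with $\mathrm{dom}(f)=\{x: f(x)\neq\emptyset\}$; it is total if $\mathrm{dom}(f)=X$. A realizer of $f$ is a partial $F:\subseteq\mathbb{N}^{\mathbb{N}}\to\mathbb{N}^{\mathbb{N}}$ such that $F(p)$ is defined and $\delta_YF(p)\in f(\delta_X(p))$ for all $p$ with $\delta_X(p)\in\mathrm{dom}(f)$. $f$ is continuous if it has a continuous realizer. Baire space $\mathbb{N}^{\mathbb{N}}$ is represented by the identity. $\langle\cdot,\cdot\rangle$ is a computable pairing on $\mathbb{N}^{\mathbb{N}}$ and $\langle p_0,p_1,\dots\rangle\langle n,k\rangle=p_n(k)$. $f\leq_{\mathrm W}g$ iff there are computable $H,K:\subseteq\mathbb{N}^{\mathbb{N}}\to\mathbb{N}^{\mathbb{N}}$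 such that for every realizer $G$ of $g$ the function $p\mapsto H\langle p,GK(p)\rangle$ is a realizer of $f$. The parallelization of $f:\subseteq X\rightrightarrows Y$ is $\widehat{f}:\subseteq X^{\mathbb{N}}\rightrightarrows Y^{\mathbb{N}}$, $\widehat{f}((x_i)_i)=\prod_{i}f(x_i)$, with $X^{\mathbb{N}}$ represented by $\langle p_0,p_1,\dots\rangle\mapsto(\delta_X(p_i))_i$. $f\leq_{\widehat{\mathrm W}}g$ iff $\widehat{f}\leq_{\mathrm W}\widehat{g}$; equivalence classes are parallel Weihrauch degrees. $\boldsymbol{\emptyset}$ is an extra object with an empty set of realizers (and $\widehat{\boldsymbol\emptyset}=\boldsymbol\emptyset$), to which the reducibilities are extended by the same definition; its degree is $\mathbf{0}$. Fix a set $\mathcal{R}$ of represented spaces that contains $(\mathbb{N}^{\mathbb{N}},\mathrm{id})$ and is closed under products $X\times U$ (represented by $\langle p,q\rangle\mapsto(\delta_X(p),\delta_U(q))$), direct sums $X\oplus U=(\{0\}\times X)\cup(\{1\}\times U)$ (where a name is a first entry, zero for the left and non-zero for the right summand, followed by a name of the element) and countable powers. $\widehat{\mathcal{W}}$ consists of $\mathbf{0}$ and all parallel Weihrauch degrees of multi-valued functions $f:\subseteq X\rightrightarrows Y$ with $X,Y\in\mathcal{R}$ and at least one computable point in $\mathrm{dom}(f)$, ordered by $\leq_{\widehat{\mathrm W}}$; this is the parallel Weihrauch lattice. *)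

theory Defs
  imports
    "HOL-Analysis.Function_Topology"
    "HOL-Algebra.Order"
    "HOL-Library.Nat_Bijection"
begin

type_synonym baire = "nat \<Rightarrow> nat"

section \<open>Computability on Baire space\<close>

text \<open>
  Partial recursive functions relative to an oracle. With oracle \<open>p\<close>, a program denotes a
  partial function from lists of numbers to numbers; \<open>eval p e xs y\<close> says that \<open>e\<close> halts
  on \<open>xs\<close> with output \<open>y\<close>.
\<close>

datatype prog =
    ZeroFn
  | SuccFn
  | Proj nat
  | Oracle
  | Comp prog "prog list"
  | PrimRec prog prog
  | Minim prog

inductive eval :: "baire \<Rightarrow> prog \<Rightarrow> nat list \<Rightarrow> nat \<Rightarrow> bool" for p :: baire where
  zero: "eval p ZeroFn xs 0"
| succ: "eval p SuccFn (x # xs) (Suc x)"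
| proj: "i < length xs \<Longrightarrow> eval p (Proj i) xs (xs ! i)"
| oracle_query: "eval p Oracle (x # xs) (p x)"
| comp: "list_all2 (\<lambda>g y. eval p g xs y) gs ys \<Longrightarrow> eval p f ys z \<Longrightarrow> eval p (Comp f gs) xs z"
| prim_0: "eval p f xs y \<Longrightarrow> eval p (PrimRec f g) (0 # xs) y"
| prim_Suc: "eval p (PrimRec f g) (n # xs) y \<Longrightarrow> eval p g (n # y # xs) z
    \<Longrightarrow> eval p (PrimRec f g) (Suc n # xs) z"
| minim: "eval p f (n # xs) 0 \<Longrightarrow> (\<forall>m<n. \<exists>y. eval p f (m # xs) (Suc y))
    \<Longrightarrow> eval p (Minim f) xs n"

text \<open>
  A partial function is computable if some program computes it on its whole domain. The program
  may also produce output outside the domain, i.e. restrictions of computable functions are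
  computable.
\<close>

definition computable_fun :: "(baire \<rightharpoonup> baire) \<Rightarrow> bool" where
  "computable_fun F \<longleftrightarrow> (\<exists>e. \<forall>p q. F p = Some q \<longrightarrow> (\<forall>n. eval p e [n] (q n)))"

text \<open>The oracle is fixed to the zero sequence, which makes oracle queries useless.\<close>

definition computable_seq :: "baire \<Rightarrow> bool" where
  "computable_seq p \<longleftrightarrow> (\<exists>e. \<forall>n. eval (\<lambda>_. 0) e [n] (p n))"

definition bpair :: "baire \<Rightarrow> baire \<Rightarrow> baire" where
  "bpair p q n = (if even n then p (n div 2) else q (n div 2))"

definition bfst :: "baire \<Rightarrow> baire" where
  "bfst r n = r (2 * n)"

definition bsnd :: "baire \<Rightarrow> baire" where
  "bsnd r n = r (2 * n + 1)"

text \<open>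
  The inverse of countable tupling: \<open>component r n = p\<^sub>n\<close> for
  \<open>r = \<langle>p\<^sub>0, p\<^sub>1, \<dots>\<rangle>\<close>.
\<close>

definition component :: "baire \<Rightarrow> nat \<Rightarrow> baire" where
  "component r n k = r (prod_encode (n, k))"

section \<open>Medvedev degrees\<close>

definition medvedev_le :: "baire set \<Rightarrow> baire set \<Rightarrow> bool" (infix \<open>\<le>\<^sub>M\<close> 50) where
  "A \<le>\<^sub>M B \<longleftrightarrow> (\<exists>F. computable_fun F \<and> B \<subseteq> dom F \<and> (\<lambda>p. the (F p)) ` B \<subseteq> A)"

definition medvedev_equiv :: "(baire set \<times> baire set) set" where
  "medvedev_equiv = {(A, B). A \<le>\<^sub>M B \<and> B \<le>\<^sub>M A}"

definition medvedev_lattice :: "baire set set gorder" where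
  "medvedev_lattice =
    \<lparr>carrier = UNIV // medvedev_equiv, eq = (=), le = (\<lambda>a b. \<exists>A\<in>a. \<exists>B\<in>b. A \<le>\<^sub>M B)\<rparr>"

section \<open>Represented spaces\<close>

text \<open>
  A universe of points closed under pairs and sequences, over arbitrary atoms, so that a set of
  represented spaces over one type can be closed under products, sums and countable powers.
\<close>

datatype 'a point =
    Atom 'a
  | Number nat
  | Paired "'a point" "'a point"
  | Seq "nat \<Rightarrow> 'a point"

text \<open>
  A represented space \<open>(X, \<delta>)\<close> is given by \<open>\<delta>\<close> alone: as \<open>\<delta>\<close> is surjective, its underlying
  set is \<open>X = ran \<delta>\<close>.
\<close>

type_synonym 'a rep_space = "baire \<rightharpoonup> 'a point"

definition baire_space :: "'a rep_space" where
  "baire_space p = Some (Seq (\<lambda>n. Number (p n)))"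

definition prod_space :: "'a rep_space \<Rightarrow> 'a rep_space \<Rightarrow> 'a rep_space" where
  "prod_space X U r =
    (case (X (bfst r), U (bsnd r)) of (Some x, Some u) \<Rightarrow> Some (Paired x u) | _ \<Rightarrow> None)"

definition sum_space :: "'a rep_space \<Rightarrow> 'a rep_space \<Rightarrow> 'a rep_space" where
  "sum_space X U r =
    (if r 0 = 0 then map_option (Paired (Number 0)) (X (\<lambda>n. r (Suc n)))
     else map_option (Paired (Number 1)) (U (\<lambda>n. r (Suc n))))"

definition power_space :: "'a rep_space \<Rightarrow> 'a rep_space" where
  "power_space X r =
    (if \<forall>i. component r i \<in> dom X then Some (Seq (\<lambda>i. the (X (component r i)))) else None)"

definition computable_point :: "'a rep_space \<Rightarrow> 'a point \<Rightarrow> bool" where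
  "computable_point X x \<longleftrightarrow> (\<exists>p. computable_seq p \<and> X p = Some x)"

definition admissible :: "'a rep_space set \<Rightarrow> bool" where
  "admissible R \<longleftrightarrow> baire_space \<in> R \<and>
    (\<forall>X\<in>R. \<forall>U\<in>R. prod_space X U \<in> R \<and> sum_space X U \<in> R) \<and> (\<forall>X\<in>R. power_space X \<in> R)"

section \<open>Multi-valued functions and parallel Weihrauch degrees\<close>

definition multifun :: "'a rep_space \<Rightarrow> 'a rep_space \<Rightarrow> ('a point \<Rightarrow> 'a point set) \<Rightarrow> bool" where
  "multifun X Y f \<longleftrightarrow> (\<forall>x. f x \<subseteq> ran Y) \<and> (\<forall>x. x \<notin> ran X \<longrightarrow> f x = {})"

definition mdom :: "('a point \<Rightarrow> 'a point set) \<Rightarrow> 'a point set" where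
  "mdom f = {x. f x \<noteq> {}}"

definition total_multifun :: "'a rep_space \<Rightarrow> ('a point \<Rightarrow> 'a point set) \<Rightarrow> bool" where
  "total_multifun X f \<longleftrightarrow> mdom f = ran X"

definition realizer ::
  "'a rep_space \<Rightarrow> 'a rep_space \<Rightarrow> ('a point \<Rightarrow> 'a point set) \<Rightarrow> (baire \<rightharpoonup> baire) \<Rightarrow> bool" where
  "realizer X Y f F \<longleftrightarrow>
    (\<forall>p x. X p = Some x \<and> x \<in> mdom f \<longrightarrow> (\<exists>q y. F p = Some q \<and> Y q = Some y \<and> y \<in> f x))"

text \<open>Continuity on Baire space refers to the product topology of the discrete topology on \<open>nat\<close>.\<close>

definition continuous_multifun ::
  "'a rep_space \<Rightarrow> 'a rep_space \<Rightarrow> ('a point \<Rightarrow> 'a point set) \<Rightarrow> bool" where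
  "continuous_multifun X Y f \<longleftrightarrow>
    (\<exists>F. realizer X Y f F \<and> continuous_on (dom F) (\<lambda>p. the (F p)))"

definition power_multifun :: "('a point \<Rightarrow> 'a point set) \<Rightarrow> 'a point \<Rightarrow> 'a point set" where
  "power_multifun f x =
    (case x of Seq xs \<Rightarrow> {Seq ys |ys. \<forall>i. ys i \<in> f (xs i)} | _ \<Rightarrow> {})"

text \<open>
  \<open>Void\<close> is the extra object without realizers. It differs from the nowhere defined multi-valued
  function, which every partial function realizes.
\<close>

datatype 'a problem =
    Void
  | MultiFun "'a rep_space" "'a rep_space" "'a point \<Rightarrow> 'a point set"

fun realizer_set :: "'a problem \<Rightarrow> (baire \<rightharpoonup> baire) set" where
  "realizer_set Void = {}"
| "realizer_set (MultiFun X Y f) = {F. realizer X Y f F}"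

fun parallelization :: "'a problem \<Rightarrow> 'a problem" where
  "parallelization Void = Void"
| "parallelization (MultiFun X Y f) = MultiFun (power_space X) (power_space Y) (power_multifun f)"

definition weihrauch_le :: "'a problem \<Rightarrow> 'a problem \<Rightarrow> bool" (infix \<open>\<le>\<^sub>W\<close> 50) where
  "f \<le>\<^sub>W g \<longleftrightarrow> (\<exists>H K. computable_fun H \<and> computable_fun K \<and>
    (\<forall>G\<in>realizer_set g.
      (\<lambda>p. Option.bind (K p) (\<lambda>k. Option.bind (G k) (\<lambda>q. H (bpair p q)))) \<in> realizer_set f))"

definition parallel_weihrauch_le :: "'a problem \<Rightarrow> 'a problem \<Rightarrow> bool" (infix \<open>\<le>\<^sub>P\<^sub>W\<close> 50) where
  "f \<le>\<^sub>P\<^sub>W g \<longleftrightarrow> parallelization f \<le>\<^sub>W parallelization g"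

definition problems :: "'a rep_space set \<Rightarrow> 'a problem set" where
  "problems R = insert Void {MultiFun X Y f |X Y f.
    X \<in> R \<and> Y \<in> R \<and> multifun X Y f \<and> (\<exists>x\<in>mdom f. computable_point X x)}"

definition parallel_weihrauch_equiv :: "'a rep_space set \<Rightarrow> ('a problem \<times> 'a problem) set" where
  "parallel_weihrauch_equiv R =
    {(f, g). f \<in> problems R \<and> g \<in> problems R \<and> f \<le>\<^sub>P\<^sub>W g \<and> g \<le>\<^sub>P\<^sub>W f}"

definition parallel_degree :: "'a rep_space set \<Rightarrow> 'a problem \<Rightarrow> 'a problem set" where
  "parallel_degree R f = parallel_weihrauch_equiv R `` {f}"

definition parallel_weihrauch_lattice :: "'a rep_space set \<Rightarrow> 'a problem set gorder" where
  "parallel_weihrauch_lattice R =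
    \<lparr>carrier = problems R // parallel_weihrauch_equiv R, eq = (=),
     le = (\<lambda>a b. \<exists>f\<in>a. \<exists>g\<in>b. f \<le>\<^sub>P\<^sub>W g)\<rparr>"

end

theory Submission
  imports Defs
begin

text \<open>
  The embedding sends the degree of a nonempty set \<open>A\<close> to the problem that has \<open>A\<close>
  as its set of solutions for every instance, and the top degree, which is that of
  the empty set, to \<open>Void\<close>, the top of the parallel Weihrauch order.

  Two characterizations carry the proof. In the first, a problem \<open>g\<close> with a realizer lies above
  the constant problem with value \<open>A\<close> iff the parallelization of \<open>g\<close> has a computable instance
  whose solution set \<open>S\<close> satisfies \<open>A \<le>\<^sub>M S\<close> (\<open>constant_problem_le_iff\<close>): instances of a
  constant problem carry no information, so one computable instance serves them all. Parallelizing
  the constant problem is harmless because \<open>A\<close> and the set of sequences in \<open>A\<close> have the same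
  Medvedev degree. In the second, \<open>g\<close> lies below the constant problem iff some computable function
  turns an instance \<open>p\<close> of the parallelization of \<open>g\<close>, together with any \<open>a \<in> A\<close>, into a solution
  of \<open>p\<close> (\<open>le_constant_problem_iff\<close>).

  For \<open>g\<close> constant with value \<open>B \<noteq> {}\<close> the first one says \<open>A \<le>\<^sub>M B\<close>, so the map preserves and
  reflects the order. If \<open>g\<close> is above the constant problems for \<open>A\<close> and \<open>B\<close>, then two
  computable instances of its parallelization can be interleaved into a single one; the solution set
  of the latter is an upper bound of \<open>A\<close> and \<open>B\<close> in the Medvedev order and hence above their
  least upper bound (\<open>constant_problem_lub\<close>). If \<open>g\<close> is below both, then a tagged element of
  either set suffices for solving \<open>g\<close>, so \<open>g\<close> is below the constant problem for the disjoint
  sum, which is a lower bound in the Medvedev order and hence below the greatest one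
  (\<open>constant_problem_glb\<close>).
\<close>

section \<open>Programs\<close>

text \<open>
  Replacing each oracle query by a program for the answer composes computable functions; with
  \<open>ZeroFn\<close> as that program, it removes the dependence on the oracle.
\<close>

primrec subst_oracle :: "prog \<Rightarrow> prog \<Rightarrow> prog" where
  "subst_oracle d ZeroFn = ZeroFn"
| "subst_oracle d SuccFn = SuccFn"
| "subst_oracle d (Proj i) = Proj i"
| "subst_oracle d Oracle = Comp d [Proj 0]"
| "subst_oracle d (Comp f gs) = Comp (subst_oracle d f) (map (subst_oracle d) gs)"
| "subst_oracle d (PrimRec f g) = PrimRec (subst_oracle d f) (subst_oracle d g)"
| "subst_oracle d (Minim f) = Minim (subst_oracle d f)"

lemma eval_Proj: "i < length xs \<Longrightarrow> xs ! i = y \<Longrightarrow> eval p (Proj i) xs y"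
  using eval.proj by blast

lemma eval_Comp1: "eval p g xs y \<Longrightarrow> eval p f [y] z \<Longrightarrow> eval p (Comp f [g]) xs z"
  by (rule eval.comp[where ys = "[y]"]) auto

lemma eval_Comp2:
  "eval p g xs y \<Longrightarrow> eval p h xs y' \<Longrightarrow> eval p f [y, y'] z \<Longrightarrow> eval p (Comp f [g, h]) xs z"
  by (rule eval.comp[where ys = "[y, y']"]) auto

lemma eval_subst_oracle:
  assumes "\<And>n. eval p d [n] (q n)"
  shows "eval q e xs y \<Longrightarrow> eval p (subst_oracle d e) xs y"
proof (induction rule: eval.induct)
  case (oracle_query x xs)
  have "eval p (Comp d [Proj 0]) (x # xs) (q x)"
    by (rule eval_Comp1[where y = x]) (auto intro: eval_Proj assms)
  then show ?case by simp
next
  case (comp xs gs ys f z)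
  then show ?case
    by (auto intro!: eval.comp[where ys = ys] simp: list_all2_map1 elim: list_all2_mono)
next
  case (minim f n xs)
  then show ?case by (auto intro!: eval.minim)
qed (auto intro: eval.intros)

section \<open>Recursive functions on numbers\<close>

definition recursive1 :: "(nat \<Rightarrow> nat) \<Rightarrow> bool" where
  "recursive1 h \<longleftrightarrow> (\<exists>e. \<forall>p n. eval p e [n] (h n))"

definition recursive2 :: "(nat \<Rightarrow> nat \<Rightarrow> nat) \<Rightarrow> bool" where
  "recursive2 h \<longleftrightarrow> (\<exists>e. \<forall>p m n. eval p e [m, n] (h m n))"

lemma eval_const: "\<exists>e. \<forall>p xs. eval p e xs c"
proof (induction c)
  case 0
  show ?case using eval.zero by blast
next
  case (Suc c)
  then obtain e where "\<forall>p xs. eval p e xs c" by blast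
  then have "\<forall>p xs. eval p (Comp SuccFn [e]) xs (Suc c)"
    by (auto intro: eval_Comp1 eval.succ)
  then show ?case by blast
qed

lemma recursive1_const: "recursive1 (\<lambda>_. c)"
  using eval_const unfolding recursive1_def by blast

lemma recursive1_id: "recursive1 (\<lambda>n. n)"
  unfolding recursive1_def by (rule exI[of _ "Proj 0"]) (auto intro: eval_Proj)

lemma recursive2_fst: "recursive1 f \<Longrightarrow> recursive2 (\<lambda>m n. f m)"
proof -
  assume "recursive1 f"
  then obtain e where "\<And>p n. eval p e [n] (f n)" unfolding recursive1_def by blast
  then have "eval p (Comp e [Proj 0]) [m, n] (f m)" for p m n
    by (auto intro!: eval_Comp1[where y = m] eval_Proj)
  then show ?thesis unfolding recursive2_def by blast
qed

lemma recursive2_snd: "recursive1 f \<Longrightarrow> recursive2 (\<lambda>m n. f n)"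
proof -
  assume "recursive1 f"
  then obtain e where "\<And>p n. eval p e [n] (f n)" unfolding recursive1_def by blast
  then have "eval p (Comp e [Proj 1]) [m, n] (f n)" for p m n
    by (auto intro!: eval_Comp1[where y = n] eval_Proj)
  then show ?thesis unfolding recursive2_def by blast
qed

lemma recursive1_comp:
  assumes "recursive1 f" and "recursive1 g"
  shows "recursive1 (\<lambda>n. f (g n))"
proof -
  obtain d where d: "\<And>p n. eval p d [n] (f n)" using assms(1) unfolding recursive1_def by blast
  obtain e where e: "\<And>p n. eval p e [n] (g n)" using assms(2) unfolding recursive1_def by blast
  have "eval p (Comp d [e]) [n] (f (g n))" for p n by (rule eval_Comp1[OF e d])
  then show ?thesis unfolding recursive1_def by blast
qed

lemma recursive1_Suc: "recursive1 f \<Longrightarrow> recursive1 (\<lambda>n. Suc (f n))"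
proof (rule recursive1_comp[of Suc])
  show "recursive1 Suc" unfolding recursive1_def using eval.succ by blast
qed

lemma recursive1_comp2:
  assumes "recursive2 f" and "recursive1 g" and "recursive1 h"
  shows "recursive1 (\<lambda>n. f (g n) (h n))"
proof -
  obtain c where c: "\<And>p m n. eval p c [m, n] (f m n)"
    using assms(1) unfolding recursive2_def by blast
  obtain d where d: "\<And>p n. eval p d [n] (g n)" using assms(2) unfolding recursive1_def by blast
  obtain e where e: "\<And>p n. eval p e [n] (h n)" using assms(3) unfolding recursive1_def by blast
  have "eval p (Comp c [d, e]) [n] (f (g n) (h n))" for p n by (rule eval_Comp2[OF d e c])
  then show ?thesis unfolding recursive1_def by blast
qed

lemma recursive2_comp2:
  assumes "recursive2 f" and "recursive2 g" and "recursive2 h"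
  shows "recursive2 (\<lambda>m n. f (g m n) (h m n))"
proof -
  obtain c where c: "\<And>p m n. eval p c [m, n] (f m n)"
    using assms(1) unfolding recursive2_def by blast
  obtain d where d: "\<And>p m n. eval p d [m, n] (g m n)"
    using assms(2) unfolding recursive2_def by blast
  obtain e where e: "\<And>p m n. eval p e [m, n] (h m n)"
    using assms(3) unfolding recursive2_def by blast
  have "eval p (Comp c [d, e]) [m, n] (f (g m n) (h m n))" for p m n
    by (rule eval_Comp2[OF d e c])
  then show ?thesis unfolding recursive2_def by blast
qed

lemma recursive1_primrec:
  assumes "recursive2 g" and "\<And>m. f (Suc m) = g m (f m)"
  shows "recursive1 f"
proof -
  obtain b where b: "\<And>p xs. eval p b xs (f 0)" using eval_const by blast
  obtain s where s: "\<And>p m y. eval p s [m, y] (g m y)"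
    using assms(1) unfolding recursive2_def by blast
  have "eval p (PrimRec b s) [n] (f n)" for p n
    by (induction n) (auto simp: assms(2) intro: b s eval.prim_0 eval.prim_Suc)
  then show ?thesis unfolding recursive1_def by blast
qed

lemma recursive2_add: "recursive2 (+)"
proof -
  have "eval p (PrimRec (Proj 0) (Comp SuccFn [Proj 1])) [m, n] (m + n)" for p m n
  proof (induction m)
    case (Suc m)
    then show ?case
      by (auto intro!: eval.prim_Suc[where y = "m + n"] eval_Comp1[where y = "m + n"]
          eval.succ eval_Proj)
  qed (auto intro!: eval.prim_0 eval_Proj)
  then show ?thesis unfolding recursive2_def by blast
qed

lemma recursive2_diff: "recursive2 (-)"
proof -
  have "recursive1 (\<lambda>n. n - 1)"
    by (rule recursive1_primrec[OF recursive2_fst[OF recursive1_id]]) simp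
  then obtain d where d: "\<And>p n. eval p d [n] (n - 1)" unfolding recursive1_def by blast
  have flipped: "eval p (PrimRec (Proj 0) (Comp d [Proj 1])) [n, m] (m - n)" for p m n
  proof (induction n)
    case (Suc n)
    have "m - Suc n = (m - n) - 1" by simp
    then have "eval p d [m - n] (m - Suc n)" using d by metis
    with Suc show ?case
      by (auto intro!: eval.prim_Suc[where y = "m - n"] eval_Comp1[where y = "m - n"] eval_Proj)
  qed (auto intro!: eval.prim_0 eval_Proj)
  have "eval p (Comp (PrimRec (Proj 0) (Comp d [Proj 1])) [Proj 1, Proj 0]) [m, n] (m - n)"
    for p m n
    by (rule eval_Comp2[OF _ _ flipped]) (auto intro: eval_Proj)
  then show ?thesis unfolding recursive2_def by blast
qed

lemmas recursive1_add = recursive1_comp2[OF recursive2_add]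
lemmas recursive1_diff = recursive1_comp2[OF recursive2_diff]
lemmas recursive2_add' = recursive2_comp2[OF recursive2_add]

lemma recursive1_double: "recursive1 ((*) 2)"
proof -
  have "recursive1 (\<lambda>n. n + n)" by (intro recursive1_add recursive1_id)
  then show ?thesis by (simp add: mult_2[abs_def])
qed

lemma recursive1_mod2: "recursive1 (\<lambda>n. n mod 2)"
proof (rule recursive1_primrec)
  show "recursive2 (\<lambda>m y. 1 - y)"
    by (rule recursive2_snd) (intro recursive1_diff recursive1_const recursive1_id)
  show "Suc m mod 2 = 1 - m mod 2" for m by presburger
qed

lemma recursive1_div2: "recursive1 (\<lambda>n. n div 2)"
proof (rule recursive1_primrec)
  show "recursive2 (\<lambda>m y. m mod 2 + y)"
    by (intro recursive2_add' recursive2_fst recursive2_snd recursive1_mod2 recursive1_id)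
  show "Suc m div 2 = m mod 2 + m div 2" for m by presburger
qed

lemma recursive1_triangle: "recursive1 triangle"
proof (rule recursive1_primrec)
  show "recursive2 (\<lambda>m y. Suc m + y)"
    by (intro recursive2_add' recursive2_fst recursive2_snd recursive1_Suc recursive1_id)
  show "triangle (Suc m) = Suc m + triangle m" for m by simp
qed

lemma recursive1_prod_encode:
  assumes "recursive1 f" and "recursive1 g"
  shows "recursive1 (\<lambda>n. prod_encode (f n, g n))"
  unfolding prod_encode_def prod.case
  by (intro recursive1_add recursive1_comp[OF recursive1_triangle] assms)

lemma prod_encode_diagonal:
  "triangle (m + k) \<le> prod_encode (m, k)" "prod_encode (m, k) < triangle (Suc (m + k))"
  by (auto simp: prod_encode_def)

lemma triangle_mono: "m \<le> n \<Longrightarrow> triangle m \<le> triangle n"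
  by (rule lift_Suc_mono_le[of triangle]) auto

text \<open>
  The decoding of pairs is reduced to its diagonal, the sum of both components: the codes of the
  pairs on diagonal \<open>d\<close> fill the interval from \<open>triangle d\<close> to below \<open>triangle (Suc d)\<close>, so
  unbounded search finds \<open>d\<close> as the least number whose successor has a triangle number above the
  code.
\<close>

lemma recursive1_diagonal: "recursive1 (\<lambda>n. fst (prod_decode n) + snd (prod_decode n))"
proof -
  have "recursive2 (\<lambda>d n. Suc n - triangle (Suc d))"
    by (intro recursive2_comp2[OF recursive2_diff] recursive2_fst recursive2_snd
        recursive1_comp[OF recursive1_triangle] recursive1_Suc recursive1_id)
  then obtain e where e: "\<And>p d n. eval p e [d, n] (Suc n - triangle (Suc d))"
    unfolding recursive2_def by blast
  have "eval p (Minim e) [n] (fst (prod_decode n) + snd (prod_decode n))" for p n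
  proof -
    obtain i k where n: "n = prod_encode (i, k)"
      by (metis prod_decode_inverse surj_pair)
    show ?thesis
    proof (rule eval.minim)
      have "Suc n - triangle (Suc (i + k)) = 0"
        using prod_encode_diagonal(2)[of i k] n by simp
      then have "eval p e [i + k, n] 0" using e by metis
      then show "eval p e [fst (prod_decode n) + snd (prod_decode n), n] 0"
        by (simp add: n)
      show "\<forall>d<fst (prod_decode n) + snd (prod_decode n). \<exists>y. eval p e [d, n] (Suc y)"
      proof (intro allI impI)
        fix d assume "d < fst (prod_decode n) + snd (prod_decode n)"
        then have "triangle (Suc d) \<le> triangle (i + k)"
          by (intro triangle_mono) (simp add: n)
        then have "Suc n - triangle (Suc d) = Suc (n - triangle (Suc d))"
          using prod_encode_diagonal(1)[of i k] n by simp
        then show "\<exists>y. eval p e [d, n] (Suc y)" using e by metis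
      qed
    qed
  qed
  then show ?thesis unfolding recursive1_def by blast
qed

lemma recursive1_prod_decode_fst: "recursive1 (\<lambda>n. fst (prod_decode n))"
proof -
  have "fst (prod_decode n) = n - triangle (fst (prod_decode n) + snd (prod_decode n))" for n
    using prod_decode_inverse[of n] by (cases "prod_decode n") (auto simp: prod_encode_def)
  moreover have "recursive1 (\<lambda>n. n - triangle (fst (prod_decode n) + snd (prod_decode n)))"
    by (intro recursive1_diff recursive1_id recursive1_comp[OF recursive1_triangle]
        recursive1_diagonal)
  ultimately show ?thesis by simp
qed

lemma recursive1_prod_decode_snd: "recursive1 (\<lambda>n. snd (prod_decode n))"
proof -
  have "recursive1 (\<lambda>n. (fst (prod_decode n) + snd (prod_decode n)) - fst (prod_decode n))"
    by (intro recursive1_diff recursive1_diagonal recursive1_prod_decode_fst)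
  then show ?thesis by simp
qed

section \<open>Computable functions on Baire space\<close>

lemma computable_fun_bind:
  assumes "computable_fun F" and "computable_fun G"
  shows "computable_fun (\<lambda>p. Option.bind (F p) G)"
proof -
  obtain d where d: "\<And>p q n. F p = Some q \<Longrightarrow> eval p d [n] (q n)"
    using assms(1) unfolding computable_fun_def by blast
  obtain e where e: "\<And>p q n. G p = Some q \<Longrightarrow> eval p e [n] (q n)"
    using assms(2) unfolding computable_fun_def by blast
  have "eval p (subst_oracle d e) [n] (r n)" if "Option.bind (F p) G = Some r" for p r n
    using that by (auto simp: bind_eq_Some_conv intro: eval_subst_oracle d e)
  then show ?thesis unfolding computable_fun_def by blast
qed

lemma computable_fun_compose:
  assumes "computable_fun (\<lambda>p. Some (f p))" and "computable_fun G"
  shows "computable_fun (\<lambda>p. G (f p))"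
  using computable_fun_bind[OF assms] by simp

lemma computable_fun_reindex:
  assumes "recursive1 h"
  shows "computable_fun (\<lambda>p. Some (\<lambda>n. p (h n)))"
proof -
  obtain e where e: "\<And>p n. eval p e [n] (h n)" using assms unfolding recursive1_def by blast
  have "eval p (Comp Oracle [e]) [n] (p (h n))" for p n
    by (rule eval_Comp1[OF e eval.oracle_query])
  then show ?thesis unfolding computable_fun_def by auto
qed

lemma computable_seq_iff:
  "computable_seq k \<longleftrightarrow> computable_fun (\<lambda>p. Some k)"
proof
  assume "computable_seq k"
  then obtain e where "\<And>n. eval (\<lambda>_. 0) e [n] (k n)" unfolding computable_seq_def by blast
  then have "eval p (subst_oracle ZeroFn e) [n] (k n)" for p n
    by (rule eval_subst_oracle[OF eval.zero])
  then show "computable_fun (\<lambda>p. Some k)" unfolding computable_fun_def by auto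
qed (auto simp: computable_fun_def computable_seq_def)

lemma computable_seq_zero: "computable_seq (\<lambda>_. 0)"
  unfolding computable_seq_def using eval.zero by blast

text \<open>
  A case distinction must not run the branch that is not taken, since that branch may diverge, and
  \<open>Comp\<close> evaluates all its arguments. A primitive recursion, however, evaluates its step only if
  the counter is positive. So each branch becomes the step of a recursion that starts with zero and
  whose counter vanishes exactly if the branch is not taken, and the two results are added. A step
  that ignores the previous value may be repeated, so any positive counter will do.
\<close>

definition guarded :: "prog \<Rightarrow> prog" where
  "guarded e = PrimRec ZeroFn (Comp e [Proj 2])"

lemma eval_guarded:
  assumes "c \<noteq> 0 \<Longrightarrow> eval p e [n] y"
  shows "eval p (guarded e) [c, n] (if c = 0 then 0 else y)"
proof (cases "c = 0")
  case True
  then show ?thesis by (auto simp: guarded_def intro: eval.prim_0 eval.zero)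
next
  case False
  then have step: "eval p (Comp e [Proj 2]) [m, z, n] y" for m z
    using assms by (auto intro!: eval_Comp1[where y = n] eval_Proj)
  have "eval p (guarded e) [m, n] (if m = 0 then 0 else y)" for m
  proof (induction m)
    case (Suc m)
    with step[of m] show ?case
      unfolding guarded_def by (auto intro: eval.prim_Suc split: if_splits)
  qed (auto simp: guarded_def intro: eval.prim_0 eval.zero)
  then show ?thesis .
qed

lemma eval_case_zero:
  "\<exists>t. \<forall>p n v y. eval p c [n] v \<longrightarrow> (v = 0 \<longrightarrow> eval p d [n] y) \<longrightarrow> (v \<noteq> 0 \<longrightarrow> eval p e [n] y) \<longrightarrow>
    eval p t [n] y"
proof -
  obtain s where s: "\<And>p m n. eval p s [m, n] (m + n)"
    using recursive2_add unfolding recursive2_def by blast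
  obtain z where z: "\<And>p n. eval p z [n] (1 - n)"
    using recursive1_diff[OF recursive1_const recursive1_id] unfolding recursive1_def by blast
  define d' where "d' = Comp (guarded d) [Comp z [c], Proj 0]"
  define e' where "e' = Comp (guarded e) [c, Proj 0]"
  have "eval p (Comp s [d', e']) [n] y"
    if c: "eval p c [n] v" and d: "v = 0 \<longrightarrow> eval p d [n] y" and e: "v \<noteq> 0 \<longrightarrow> eval p e [n] y"
    for p n v y
  proof -
    have 0: "eval p (Proj 0) [n] n" by (auto intro: eval_Proj)
    have "eval p d' [n] (if 1 - v = 0 then 0 else y)"
      unfolding d'_def by (rule eval_Comp2[OF eval_Comp1[OF c z] 0 eval_guarded]) (use d in simp)
    moreover have "eval p e' [n] (if v = 0 then 0 else y)"
      unfolding e'_def by (rule eval_Comp2[OF c 0 eval_guarded]) (use e in simp)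
    ultimately have "eval p (Comp s [d', e']) [n]
        ((if 1 - v = 0 then 0 else y) + (if v = 0 then 0 else y))"
      using s by (rule eval_Comp2)
    then show ?thesis by (cases v) auto
  qed
  then show ?thesis by blast
qed

lemma computable_fun_case:
  assumes "computable_fun F" and "computable_fun G"
  shows "computable_fun (\<lambda>p. if p m = 0 then F p else G p)"
proof -
  obtain d where d: "\<And>p q n. F p = Some q \<Longrightarrow> eval p d [n] (q n)"
    using assms(1) unfolding computable_fun_def by blast
  obtain e where e: "\<And>p q n. G p = Some q \<Longrightarrow> eval p e [n] (q n)"
    using assms(2) unfolding computable_fun_def by blast
  obtain k where k: "\<And>p xs. eval p k xs m" using eval_const by blast
  have c: "eval p (Comp Oracle [k]) [n] (p m)" for p n
    by (rule eval_Comp1[OF k eval.oracle_query])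
  obtain t where t: "\<And>p n v y. eval p (Comp Oracle [k]) [n] v \<Longrightarrow> (v = 0 \<Longrightarrow> eval p d [n] y) \<Longrightarrow>
      (v \<noteq> 0 \<Longrightarrow> eval p e [n] y) \<Longrightarrow> eval p t [n] y"
    using eval_case_zero[of "Comp Oracle [k]" d e] by blast
  have "eval p t [n] (q n)"
    if "(if p m = 0 then F p else G p) = Some q" for p q n
    using that by (intro t[OF c]) (auto intro: d e)
  then show ?thesis unfolding computable_fun_def by blast
qed

text \<open>
  Whereas \<open>computable_fun_case\<close> chooses between two functions once and for all by looking at the
  argument, this chooses for each output position.
\<close>

lemma computable_fun_select:
  assumes "recursive1 c" and "computable_fun F" and "computable_fun G"
  shows "computable_fun (\<lambda>p. Option.bind (F p) (\<lambda>u. Option.bind (G p) (\<lambda>v.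
    Some (\<lambda>n. if c n = 0 then u n else v n))))"
proof -
  obtain b where b: "\<And>p n. eval p b [n] (c n)" using assms(1) unfolding recursive1_def by blast
  obtain d where d: "\<And>p q n. F p = Some q \<Longrightarrow> eval p d [n] (q n)"
    using assms(2) unfolding computable_fun_def by blast
  obtain e where e: "\<And>p q n. G p = Some q \<Longrightarrow> eval p e [n] (q n)"
    using assms(3) unfolding computable_fun_def by blast
  obtain t where t: "\<And>p n v y. eval p b [n] v \<Longrightarrow> (v = 0 \<Longrightarrow> eval p d [n] y) \<Longrightarrow>
      (v \<noteq> 0 \<Longrightarrow> eval p e [n] y) \<Longrightarrow> eval p t [n] y"
    using eval_case_zero[of b d e] by blast
  have "eval p t [n] (if c n = 0 then u n else v n)"
    if "F p = Some u" "G p = Some v" for p u v n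
    by (intro t[OF b]) (simp_all add: d[OF that(1)] e[OF that(2)])
  then show ?thesis unfolding computable_fun_def
    by (intro exI[of _ t]) (auto simp: bind_eq_Some_conv)
qed

lemma computable_fun_id: "computable_fun Some"
  using computable_fun_reindex[OF recursive1_id] by simp

lemma computable_fun_bfst: "computable_fun (\<lambda>p. Some (bfst p))"
  using computable_fun_reindex[OF recursive1_double] by (simp add: bfst_def[abs_def])

lemma computable_fun_bsnd: "computable_fun (\<lambda>p. Some (bsnd p))"
  using computable_fun_reindex[OF recursive1_Suc[OF recursive1_double]]
  by (simp add: bsnd_def[abs_def])

lemma computable_fun_bpair:
  assumes "computable_fun F" and "computable_fun G"
  shows "computable_fun (\<lambda>p. Option.bind (F p) (\<lambda>u. map_option (bpair u) (G p)))"
proof -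
  note half = computable_fun_reindex[OF recursive1_div2]
  have "bpair u v = (\<lambda>n. if n mod 2 = 0 then u (n div 2) else v (n div 2))" for u v
    by (auto simp: bpair_def)
  with computable_fun_select[OF recursive1_mod2 computable_fun_bind[OF assms(1) half]
      computable_fun_bind[OF assms(2) half]]
  show ?thesis by (simp add: map_conv_bind_option comp_def)
qed

lemma bfst_bpair [simp]: "bfst (bpair p q) = p"
  by (auto simp: bfst_def bpair_def)

lemma bsnd_bpair [simp]: "bsnd (bpair p q) = q"
  by (auto simp: bsnd_def bpair_def)

section \<open>Sequences of sequences\<close>

definition tuple :: "(nat \<Rightarrow> baire) \<Rightarrow> baire" where
  "tuple ps n = (case prod_decode n of (i, k) \<Rightarrow> ps i k)"

definition repeat :: "baire \<Rightarrow> baire" where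
  "repeat q = tuple (\<lambda>_. q)"

definition merge :: "baire \<Rightarrow> baire \<Rightarrow> baire" where
  "merge p q = tuple (\<lambda>i. component (if i mod 2 = 0 then p else q) (i div 2))"

definition even_components :: "baire \<Rightarrow> baire" where
  "even_components r = tuple (\<lambda>i. component r (2 * i))"

definition odd_components :: "baire \<Rightarrow> baire" where
  "odd_components r = tuple (\<lambda>i. component r (Suc (2 * i)))"

lemma component_tuple [simp]: "component (tuple ps) i = ps i"
  by (auto simp: component_def tuple_def)

lemma computable_fun_component_0: "computable_fun (\<lambda>p. Some (component p 0))"
  using computable_fun_reindex[OF recursive1_prod_encode[OF recursive1_const recursive1_id]]
  by (simp add: component_def[abs_def])

lemma computable_fun_repeat: "computable_fun (\<lambda>p. Some (repeat p))"
  using computable_fun_reindex[OF recursive1_prod_decode_snd]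
  by (simp add: repeat_def tuple_def[abs_def] case_prod_beta)

lemma computable_fun_even_components: "computable_fun (\<lambda>p. Some (even_components p))"
  using computable_fun_reindex[OF recursive1_prod_encode[OF
      recursive1_comp[OF recursive1_double recursive1_prod_decode_fst] recursive1_prod_decode_snd]]
  by (simp add: even_components_def tuple_def[abs_def] component_def case_prod_beta)

lemma computable_fun_odd_components: "computable_fun (\<lambda>p. Some (odd_components p))"
  using computable_fun_reindex[OF recursive1_prod_encode[OF recursive1_Suc[OF
      recursive1_comp[OF recursive1_double recursive1_prod_decode_fst]] recursive1_prod_decode_snd]]
  by (simp add: odd_components_def tuple_def[abs_def] component_def case_prod_beta)

lemma computable_seq_merge:
  assumes "computable_seq p" and "computable_seq q"
  shows "computable_seq (merge p q)"
proof -
  note half = computable_fun_reindex[OF recursive1_prod_encode[OF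
      recursive1_comp[OF recursive1_div2 recursive1_prod_decode_fst] recursive1_prod_decode_snd]]
  have "merge p q = (\<lambda>n. if fst (prod_decode n) mod 2 = 0
      then p (prod_encode (fst (prod_decode n) div 2, snd (prod_decode n)))
      else q (prod_encode (fst (prod_decode n) div 2, snd (prod_decode n))))"
    by (auto simp: merge_def tuple_def component_def case_prod_beta)
  with computable_fun_select[OF recursive1_comp[OF recursive1_mod2 recursive1_prod_decode_fst]
      computable_fun_bind[OF assms(1)[unfolded computable_seq_iff] half]
      computable_fun_bind[OF assms(2)[unfolded computable_seq_iff] half]]
  show ?thesis by (simp add: computable_seq_iff)
qed

section \<open>Medvedev reducibility\<close>

lemma medvedev_le_iff:
  "A \<le>\<^sub>M B \<longleftrightarrow> (\<exists>F. computable_fun F \<and> (\<forall>q\<in>B. \<exists>a\<in>A. F q = Some a))"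
proof -
  have "B \<subseteq> dom F \<and> (\<lambda>p. the (F p)) ` B \<subseteq> A \<longleftrightarrow> (\<forall>q\<in>B. \<exists>a\<in>A. F q = Some a)" for F
    by (force simp: dom_def)
  then show ?thesis unfolding medvedev_le_def by simp
qed

lemma medvedev_le_total:
  "computable_fun (\<lambda>q. Some (f q)) \<Longrightarrow> (\<And>q. q \<in> B \<Longrightarrow> f q \<in> A) \<Longrightarrow> A \<le>\<^sub>M B"
  unfolding medvedev_le_iff by (intro exI[of _ "\<lambda>q. Some (f q)"]) simp

lemma medvedev_le_superset: "B \<subseteq> A \<Longrightarrow> A \<le>\<^sub>M B"
  using computable_fun_id by (auto intro: medvedev_le_total[of "\<lambda>q. q"])

lemma medvedev_le_trans: "A \<le>\<^sub>M B \<Longrightarrow> B \<le>\<^sub>M C \<Longrightarrow> A \<le>\<^sub>M C"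
proof -
  assume "A \<le>\<^sub>M B" and "B \<le>\<^sub>M C"
  then obtain F G where "computable_fun F" "\<forall>q\<in>B. \<exists>a\<in>A. F q = Some a"
    and "computable_fun G" "\<forall>q\<in>C. \<exists>b\<in>B. G q = Some b"
    unfolding medvedev_le_iff by blast
  then show ?thesis unfolding medvedev_le_iff
    by (intro exI[of _ "\<lambda>q. Option.bind (G q) F"]) (fastforce intro: computable_fun_bind)
qed

lemma empty_medvedev_le_iff: "{} \<le>\<^sub>M B \<longleftrightarrow> B = {}"
  unfolding medvedev_le_iff using computable_fun_id by auto

text \<open>
  The solution set of the parallelized constant problem. It is Medvedev equivalent to \<open>A\<close>, by taking
  the first component of a sequence and by repeating an element forever.
\<close>

definition sequences :: "baire set \<Rightarrow> baire set" where
  "sequences A = {q. \<forall>i. component q i \<in> A}"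

lemma repeat_in_sequences: "a \<in> A \<Longrightarrow> repeat a \<in> sequences A"
  by (simp add: sequences_def repeat_def)

lemma medvedev_le_sequences: "A \<le>\<^sub>M sequences A"
  by (rule medvedev_le_total[OF computable_fun_component_0]) (simp add: sequences_def)

lemma sequences_medvedev_le: "sequences A \<le>\<^sub>M A"
  by (rule medvedev_le_total[OF computable_fun_repeat]) (rule repeat_in_sequences)

text \<open>
  A representative of the greatest lower bound of two Medvedev degrees. The tag is the first entry and
  the tagged element occupies the odd positions, so that \<open>bpair\<close> with a constant sequence attaches
  the tag.
\<close>

definition disjoint_sum :: "baire set \<Rightarrow> baire set \<Rightarrow> baire set" where
  "disjoint_sum A B = {r. if r 0 = 0 then bsnd r \<in> A else bsnd r \<in> B}"

lemma disjoint_sum_medvedev_le: "disjoint_sum A B \<le>\<^sub>M A" "disjoint_sum A B \<le>\<^sub>M B"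
proof -
  have tag: "computable_fun (\<lambda>q. Some (bpair (\<lambda>_. i) q))" for i
  proof -
    obtain e where "\<And>p xs. eval p e xs i" using eval_const by blast
    then have "computable_seq (\<lambda>_. i)" unfolding computable_seq_def by blast
    then show ?thesis
      using computable_fun_bpair[OF _ computable_fun_id, of "\<lambda>_. Some (\<lambda>_. i)"]
      by (simp add: computable_seq_iff)
  qed
  show "disjoint_sum A B \<le>\<^sub>M A"
    by (rule medvedev_le_total[OF tag[of 0]]) (simp add: disjoint_sum_def, simp add: bpair_def)
  show "disjoint_sum A B \<le>\<^sub>M B"
    by (rule medvedev_le_total[OF tag[of 1]]) (simp add: disjoint_sum_def, simp add: bpair_def)
qed

section \<open>Parallel Weihrauch reducibility\<close>

text \<open>
  If all values of a problem have names, then its realizers depend only on the relation between names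
  of instances and names of solutions. Working with this relation removes the represented spaces
  from the arguments. The value for \<open>Void\<close> is the one that fits the constant problem of the empty
  set.
\<close>

fun solutions :: "'a problem \<Rightarrow> baire \<Rightarrow> baire set" where
  "solutions Void p = {}"
| "solutions (MultiFun X Y f) p = {q. \<exists>x y. X p = Some x \<and> Y q = Some y \<and> y \<in> f x}"

text \<open>
  This ensures that each instance in the domain has a named solution, which is what makes
  realizers exist.
\<close>

fun named_values :: "'a problem \<Rightarrow> bool" where
  "named_values Void = True"
| "named_values (MultiFun X Y f) = (\<forall>x. f x \<subseteq> ran Y)"

lemma solutions_parallelization:
  "solutions (parallelization g) p = {q. \<forall>i. component q i \<in> solutions g (component p i)}"
proof (cases g)
  case (MultiFun X Y f)
  have "q \<in> solutions (parallelization g) p \<longleftrightarrow>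
      (\<forall>i. component q i \<in> solutions g (component p i))" for q
  proof
    assume "\<forall>i. component q i \<in> solutions g (component p i)"
    then have "\<exists>x y. X (component p i) = Some x \<and> Y (component q i) = Some y \<and> y \<in> f x" for i
      using MultiFun by simp
    then obtain x y where "\<And>i. X (component p i) = Some (x i) \<and> Y (component q i) = Some (y i)
        \<and> y i \<in> f (x i)" by metis
    then show "q \<in> solutions (parallelization g) p"
      by (auto simp: MultiFun power_space_def power_multifun_def dom_def)
  next
    assume "q \<in> solutions (parallelization g) p"
    then show "\<forall>i. component q i \<in> solutions g (component p i)"
      by (auto simp: MultiFun power_space_def power_multifun_def dom_def split: if_splits)
        (metis option.sel)
  qed
  then show ?thesis by blast
qed simp

lemma named_values_parallelization:
  assumes "named_values g"
  shows "named_values (parallelization g)"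
proof (cases g)
  case (MultiFun X Y f)
  have "z \<in> ran (power_space Y)" if z: "z \<in> power_multifun f x" for x z
  proof -
    obtain xs ys where z: "z = Seq ys" and "\<forall>i. ys i \<in> f (xs i)"
      using z by (cases x) (auto simp: power_multifun_def)
    then have "\<forall>i. ys i \<in> ran Y" using assms MultiFun by auto
    then have "\<forall>i. \<exists>q. Y q = Some (ys i)" by (auto simp: ran_def)
    then obtain qs where "\<And>i. Y (qs i) = Some (ys i)" by metis
    then have "power_space Y (tuple qs) = Some z"
      by (auto simp: power_space_def z)
    then show ?thesis by (auto simp: ran_def)
  qed
  then show ?thesis by (auto simp: MultiFun)
qed simp

lemma parallelization_eq_Void_iff [simp]: "parallelization g = Void \<longleftrightarrow> g = Void"
  by (cases g) auto

lemma realizer_set_iff: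
  assumes "named_values g" and "g \<noteq> Void"
  shows "G \<in> realizer_set g \<longleftrightarrow>
    (\<forall>p. solutions g p \<noteq> {} \<longrightarrow> (\<exists>q\<in>solutions g p. G p = Some q))"
proof (cases g)
  case (MultiFun X Y f)
  have "solutions g p \<noteq> {} \<longleftrightarrow> (\<exists>x. X p = Some x \<and> x \<in> mdom f)" for p
  proof -
    have "\<exists>q. Y q = Some y" if "y \<in> f x" for x y
      using assms(1) that by (auto simp: MultiFun ran_def)
    then show ?thesis by (force simp: MultiFun mdom_def)
  qed
  moreover have "(\<forall>x. X p = Some x \<and> x \<in> mdom f \<longrightarrow> (\<exists>q y. G p = Some q \<and> Y q = Some y \<and> y \<in> f x))
      \<longleftrightarrow> ((\<exists>x. X p = Some x \<and> x \<in> mdom f) \<longrightarrow> (\<exists>q\<in>solutions g p. G p = Some q))" for p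
    by (cases "X p") (auto simp: MultiFun)
  ultimately show ?thesis by (simp add: MultiFun realizer_def)
qed (use assms in simp)

lemma realizer_exists:
  assumes "named_values g" and "g \<noteq> Void"
  shows "(\<lambda>p. if solutions g p = {} then None else Some (SOME q. q \<in> solutions g p))
    \<in> realizer_set g"
  using assms by (auto simp: realizer_set_iff some_in_eq)

text \<open>
  The quantifier over realizers is eliminated: a realizer can be changed at a single instance to
  return any prescribed solution there, and one that is undefined off the domain shows that the
  instances queried lie in the domain.
\<close>

lemma weihrauch_le_iff:
  assumes "named_values f" "f \<noteq> Void" and "named_values g" "g \<noteq> Void"
  shows "f \<le>\<^sub>W g \<longleftrightarrow> (\<exists>H K. computable_fun H \<and> computable_fun K \<and>
    (\<forall>p. solutions f p \<noteq> {} \<longrightarrow> (\<exists>k. K p = Some k \<and> solutions g k \<noteq> {} \<and>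
      (\<forall>q\<in>solutions g k. \<exists>r\<in>solutions f p. H (bpair p q) = Some r))))"
proof -
  have "(\<forall>G\<in>realizer_set g.
      (\<lambda>p. Option.bind (K p) (\<lambda>k. Option.bind (G k) (\<lambda>q. H (bpair p q)))) \<in> realizer_set f) \<longleftrightarrow>
    (\<forall>p. solutions f p \<noteq> {} \<longrightarrow> (\<exists>k. K p = Some k \<and> solutions g k \<noteq> {} \<and>
      (\<forall>q\<in>solutions g k. \<exists>r\<in>solutions f p. H (bpair p q) = Some r)))" (is "?L \<longleftrightarrow> ?R") for H K
  proof
    assume R: ?R
    show ?L
    proof
      fix G assume "G \<in> realizer_set g"
      then have G: "\<forall>k. solutions g k \<noteq> {} \<longrightarrow> (\<exists>q\<in>solutions g k. G k = Some q)"
        using assms by (simp add: realizer_set_iff)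
      show "(\<lambda>p. Option.bind (K p) (\<lambda>k. Option.bind (G k) (\<lambda>q. H (bpair p q))))
          \<in> realizer_set f"
        unfolding realizer_set_iff[OF assms(1,2)]
      proof (intro allI impI)
        fix p assume "solutions f p \<noteq> {}"
        then obtain k where k: "K p = Some k" "solutions g k \<noteq> {}"
          and H: "\<forall>q\<in>solutions g k. \<exists>r\<in>solutions f p. H (bpair p q) = Some r"
          using R by blast
        obtain q where "q \<in> solutions g k" "G k = Some q" using G k(2) by blast
        with H k(1) show "\<exists>r\<in>solutions f p.
            Option.bind (K p) (\<lambda>k. Option.bind (G k) (\<lambda>q. H (bpair p q))) = Some r"
          by simp
      qed
    qed
  next
    assume L: ?L
    show ?R
    proof (intro allI impI)
      fix p assume p: "solutions f p \<noteq> {}"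
      define G where
        "G = (\<lambda>p. if solutions g p = {} then None else Some (SOME q. q \<in> solutions g p))"
      have G: "G \<in> realizer_set g" using realizer_exists[OF assms(3,4)] by (simp add: G_def)
      have val: "\<exists>r\<in>solutions f p. Option.bind (K p) (\<lambda>k. Option.bind (G k) (\<lambda>q. H (bpair p q)))
          = Some r" if "G \<in> realizer_set g" for G
        using L that p unfolding realizer_set_iff[OF assms(1,2)] by blast
      obtain k where k: "K p = Some k" "G k \<noteq> None"
        using val[OF G] by (auto simp: bind_eq_Some_conv)
      \<comment> \<open>The realizer is redirected to the given solution at the one instance that is queried.\<close>
      have "\<exists>r\<in>solutions f p. H (bpair p q) = Some r" if "q \<in> solutions g k" for q
      proof -
        have "G(k \<mapsto> q) \<in> realizer_set g"
          using G that unfolding realizer_set_iff[OF assms(3,4)] by auto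
        from val[OF this] show ?thesis by (simp add: k)
      qed
      with k show "\<exists>k. K p = Some k \<and> solutions g k \<noteq> {} \<and>
          (\<forall>q\<in>solutions g k. \<exists>r\<in>solutions f p. H (bpair p q) = Some r)"
        by (auto simp: G_def split: if_splits)
    qed
  qed
  then show ?thesis unfolding weihrauch_le_def by simp
qed

text \<open>
  \<open>Void\<close> is the greatest element, as it leaves no realizer to be transformed. It matches the
  empty set in the Medvedev order.
\<close>

lemma parallel_weihrauch_le_Void: "f \<le>\<^sub>P\<^sub>W Void"
  unfolding parallel_weihrauch_le_def weihrauch_le_def using computable_fun_id by auto

lemma Void_parallel_weihrauch_le_iff:
  assumes "named_values g"
  shows "Void \<le>\<^sub>P\<^sub>W g \<longleftrightarrow> g = Void"
proof
  assume "Void \<le>\<^sub>P\<^sub>W g"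
  then have "realizer_set (parallelization g) = {}"
    by (auto simp: parallel_weihrauch_le_def weihrauch_le_def)
  then show "g = Void"
    using realizer_exists[OF named_values_parallelization[OF assms]] by auto
qed (simp add: parallel_weihrauch_le_Void)

lemma parallel_weihrauch_le_refl: "f \<le>\<^sub>P\<^sub>W f"
  unfolding parallel_weihrauch_le_def weihrauch_le_def
  using computable_fun_bsnd computable_fun_id
  by (intro exI[of _ "\<lambda>r. Some (bsnd r)"] exI[of _ Some]) simp

lemma parallel_weihrauch_le_trans:
  assumes "f \<le>\<^sub>P\<^sub>W g" and "g \<le>\<^sub>P\<^sub>W h"
  shows "f \<le>\<^sub>P\<^sub>W h"
proof -
  obtain H K where comp: "computable_fun H" "computable_fun K"
    and fg: "\<And>G. G \<in> realizer_set (parallelization g) \<Longrightarrow>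
      (\<lambda>p. Option.bind (K p) (\<lambda>k. Option.bind (G k) (\<lambda>q. H (bpair p q))))
        \<in> realizer_set (parallelization f)"
    using assms(1) unfolding parallel_weihrauch_le_def weihrauch_le_def by blast
  obtain H' K' where comp': "computable_fun H'" "computable_fun K'"
    and gh: "\<And>G. G \<in> realizer_set (parallelization h) \<Longrightarrow>
      (\<lambda>p. Option.bind (K' p) (\<lambda>k. Option.bind (G k) (\<lambda>q. H' (bpair p q))))
        \<in> realizer_set (parallelization g)"
    using assms(2) unfolding parallel_weihrauch_le_def weihrauch_le_def by blast
  \<comment> \<open>On \<open>\<langle>p, q\<rangle>\<close>, where \<open>q\<close> solves \<open>K' (K p)\<close>, \<open>I\<close> yields \<open>\<langle>K p, q\<rangle>\<close>, and \<open>J\<close> pairs \<open>p\<close>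
    with the solution of \<open>K p\<close> that \<open>H'\<close> finds from it.\<close>
  define K'' where "K'' p = Option.bind (K p) K'" for p
  define I where "I r = Option.bind (K (bfst r)) (\<lambda>k. map_option (bpair k) (Some (bsnd r)))" for r
  define J where "J r = Option.bind (Some (bfst r))
    (\<lambda>p. map_option (bpair p) (Option.bind (I r) H'))" for r
  define H'' where "H'' r = Option.bind (J r) H" for r
  have "computable_fun K''"
    unfolding K''_def by (rule computable_fun_bind[OF comp(2) comp'(2)])
  moreover have "computable_fun I" unfolding I_def
    by (rule computable_fun_bpair[OF computable_fun_compose[OF computable_fun_bfst comp(2)]
          computable_fun_bsnd])
  then have "computable_fun J" unfolding J_def
    by (rule computable_fun_bpair[OF computable_fun_bfst computable_fun_bind[OF _ comp'(1)]])
  then have "computable_fun H''" unfolding H''_def by (rule computable_fun_bind[OF _ comp(1)])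
  moreover have "(\<lambda>p. Option.bind (K'' p) (\<lambda>k. Option.bind (G k) (\<lambda>q. H'' (bpair p q))))
      \<in> realizer_set (parallelization f)" if "G \<in> realizer_set (parallelization h)" for G
  proof -
    have "Option.bind (K'' p) (\<lambda>k. Option.bind (G k) (\<lambda>q. H'' (bpair p q))) =
      Option.bind (K p) (\<lambda>k. Option.bind (Option.bind (K' k) (\<lambda>k'. Option.bind (G k')
        (\<lambda>q. H' (bpair k q)))) (\<lambda>q. H (bpair p q)))" for p
      by (auto simp: K''_def H''_def J_def I_def bind_map_option comp_def split: bind_splits)
    with fg[OF gh[OF that]] show ?thesis by simp
  qed
  ultimately show ?thesis unfolding parallel_weihrauch_le_def weihrauch_le_def by blast
qed

section \<open>Constant problems\<close>

text \<open>
  The nowhere defined function would be the wrong image of the empty set: it lies below all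
  problems, whereas the empty set has the greatest Medvedev degree.
\<close>

definition constant_problem :: "baire set \<Rightarrow> 'a problem" where
  "constant_problem A = (if A = {} then Void else
    MultiFun baire_space baire_space
      (\<lambda>x. {y. x \<in> ran baire_space \<and> (\<exists>q\<in>A. baire_space q = Some y)}))"

lemma constant_problem_empty [simp]: "constant_problem {} = Void"
  by (simp add: constant_problem_def)

lemma ran_baire_space: "baire_space p = Some x \<Longrightarrow> x \<in> ran baire_space"
  by (rule ranI)

lemma baire_space_inject: "baire_space p = baire_space q \<longleftrightarrow> p = q"
  by (auto simp: baire_space_def fun_eq_iff)

lemma solutions_constant_problem [simp]: "solutions (constant_problem A :: 'a problem) p = A"
proof (cases "A = {}")
  case False
  have "q \<in> solutions (constant_problem A :: 'a problem) p \<longleftrightarrow> q \<in> A" for q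
  proof -
    obtain x :: "'a point" where x: "baire_space p = Some x" by (simp add: baire_space_def)
    obtain y :: "'a point" where y: "baire_space q = Some y" by (simp add: baire_space_def)
    have "(\<exists>q'\<in>A. baire_space q' = Some y) \<longleftrightarrow> q \<in> A"
      unfolding y[symmetric] baire_space_inject by blast
    with False show ?thesis
      by (simp add: constant_problem_def x y ran_baire_space[OF x])
  qed
  then show ?thesis by blast
qed (simp add: constant_problem_def)

lemma solutions_parallelization_constant_problem [simp]:
  "solutions (parallelization (constant_problem A)) p = sequences A"
  by (simp add: solutions_parallelization sequences_def)

lemma named_values_constant_problem: "named_values (constant_problem A)"
  by (auto simp: constant_problem_def ran_def)

lemma constant_problem_eq_Void_iff [simp]: "constant_problem A = Void \<longleftrightarrow> A = {}"
  by (simp add: constant_problem_def)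

text \<open>
  From left to right, the instance is the one queried for the zero sequence; from right to left,
  that instance is queried always, and the input is ignored.
\<close>

lemma constant_problem_le_iff:
  assumes "named_values g" and "g \<noteq> Void"
  shows "constant_problem A \<le>\<^sub>P\<^sub>W g \<longleftrightarrow> (\<exists>k. computable_seq k \<and>
    solutions (parallelization g) k \<noteq> {} \<and> A \<le>\<^sub>M solutions (parallelization g) k)"
proof (cases "A = {}")
  case True
  with assms show ?thesis
    by (auto simp: Void_parallel_weihrauch_le_iff empty_medvedev_le_iff)
next
  case False
  then have nonempty: "sequences A \<noteq> {}" using repeat_in_sequences by blast
  let ?S = "solutions (parallelization g)"
  have char: "constant_problem A \<le>\<^sub>P\<^sub>W g \<longleftrightarrow> (\<exists>H K. computable_fun H \<and> computable_fun K \<and>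
    (\<forall>p. \<exists>k. K p = Some k \<and> ?S k \<noteq> {} \<and> (\<forall>q\<in>?S k. \<exists>r\<in>sequences A. H (bpair p q) = Some r)))"
    using False assms nonempty unfolding parallel_weihrauch_le_def
    by (subst weihrauch_le_iff)
      (simp_all add: named_values_parallelization named_values_constant_problem)
  show ?thesis
  proof
    assume "constant_problem A \<le>\<^sub>P\<^sub>W g"
    then obtain H K where H: "computable_fun H" and K: "computable_fun K"
      and red: "\<And>p. \<exists>k. K p = Some k \<and> solutions (parallelization g) k \<noteq> {} \<and>
        (\<forall>q\<in>solutions (parallelization g) k. \<exists>r\<in>sequences A. H (bpair p q) = Some r)"
      unfolding char by blast
    define zero :: baire where "zero = (\<lambda>_. 0)"
    obtain k where k: "K zero = Some k" "solutions (parallelization g) k \<noteq> {}"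
      and sol: "\<forall>q\<in>solutions (parallelization g) k. \<exists>r\<in>sequences A. H (bpair zero q) = Some r"
      using red by blast
    have "computable_seq k"
      using K k(1) unfolding computable_fun_def computable_seq_def zero_def by blast
    moreover have "computable_fun (\<lambda>q. Some (bpair zero q))"
      using computable_fun_bpair[OF computable_seq_zero[unfolded computable_seq_iff]
          computable_fun_id] by (simp add: zero_def)
    from computable_fun_compose[OF this H] have "sequences A \<le>\<^sub>M solutions (parallelization g) k"
      using sol unfolding medvedev_le_iff by blast
    then have "A \<le>\<^sub>M solutions (parallelization g) k"
      using medvedev_le_sequences medvedev_le_trans by blast
    ultimately show "\<exists>k. computable_seq k \<and> solutions (parallelization g) k \<noteq> {} \<and>
        A \<le>\<^sub>M solutions (parallelization g) k" using k(2) by blast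
  next
    assume "\<exists>k. computable_seq k \<and> solutions (parallelization g) k \<noteq> {} \<and>
        A \<le>\<^sub>M solutions (parallelization g) k"
    then obtain k where k: "computable_seq k" "solutions (parallelization g) k \<noteq> {}"
      and "A \<le>\<^sub>M solutions (parallelization g) k" by blast
    then have "sequences A \<le>\<^sub>M solutions (parallelization g) k"
      using sequences_medvedev_le medvedev_le_trans by blast
    then obtain F where F: "computable_fun F"
      "\<forall>q\<in>solutions (parallelization g) k. \<exists>a\<in>sequences A. F q = Some a"
      unfolding medvedev_le_iff by blast
    have "computable_fun (\<lambda>r. F (bsnd r))"
      by (rule computable_fun_compose[OF computable_fun_bsnd F(1)])
    moreover have "computable_fun (\<lambda>p. Some k)" using k(1) by (simp add: computable_seq_iff)
    ultimately show "constant_problem A \<le>\<^sub>P\<^sub>W g"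
      unfolding char using k(2) F(2)
      by (intro exI[of _ "\<lambda>r. F (bsnd r)"] exI[of _ "\<lambda>p. Some k"]) simp
  qed
qed

text \<open>
  The query to the constant problem is immaterial, as every instance has the same solutions. A
  parallel query returns a sequence in \<open>A\<close>, and a single element of \<open>A\<close> provides one by
  repetition.
\<close>

lemma le_constant_problem_iff:
  assumes "named_values g" and "g \<noteq> Void"
  shows "g \<le>\<^sub>P\<^sub>W constant_problem A \<longleftrightarrow> (\<exists>H. computable_fun H \<and>
    (\<forall>p. solutions (parallelization g) p \<noteq> {} \<longrightarrow>
      (\<forall>a\<in>A. \<exists>r\<in>solutions (parallelization g) p. H (bpair p a) = Some r)))"
proof (cases "A = {}")
  case True
  then show ?thesis using parallel_weihrauch_le_Void computable_fun_id by auto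
next
  case False
  then have nonempty: "sequences A \<noteq> {}" using repeat_in_sequences by blast
  let ?S = "solutions (parallelization g)"
  have char: "g \<le>\<^sub>P\<^sub>W constant_problem A \<longleftrightarrow> (\<exists>H K. computable_fun H \<and> computable_fun K \<and>
    (\<forall>p. ?S p \<noteq> {} \<longrightarrow> (\<exists>k. K p = Some k \<and> (\<forall>q\<in>sequences A. \<exists>r\<in>?S p. H (bpair p q) = Some r))))"
    using False assms nonempty unfolding parallel_weihrauch_le_def
    by (subst weihrauch_le_iff)
      (simp_all add: named_values_parallelization named_values_constant_problem)
  show ?thesis
  proof
    assume "g \<le>\<^sub>P\<^sub>W constant_problem A"
    then obtain H where H: "computable_fun H"
      and red: "\<And>p q. solutions (parallelization g) p \<noteq> {} \<Longrightarrow> q \<in> sequences A \<Longrightarrow>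
        \<exists>r\<in>solutions (parallelization g) p. H (bpair p q) = Some r"
      unfolding char by blast
    have "computable_fun (\<lambda>r. Some (bpair (bfst r) (repeat (bsnd r))))"
      using computable_fun_bpair[OF computable_fun_bfst
          computable_fun_compose[OF computable_fun_bsnd computable_fun_repeat]] by simp
    from computable_fun_compose[OF this H]
    show "\<exists>H. computable_fun H \<and> (\<forall>p. solutions (parallelization g) p \<noteq> {} \<longrightarrow>
        (\<forall>a\<in>A. \<exists>r\<in>solutions (parallelization g) p. H (bpair p a) = Some r))"
      using red repeat_in_sequences
      by (intro exI[of _ "\<lambda>r. H (bpair (bfst r) (repeat (bsnd r)))"]) simp
  next
    assume "\<exists>H. computable_fun H \<and> (\<forall>p. solutions (parallelization g) p \<noteq> {} \<longrightarrow>
        (\<forall>a\<in>A. \<exists>r\<in>solutions (parallelization g) p. H (bpair p a) = Some r))"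
    then obtain H where H: "computable_fun H"
      and red: "\<And>p a. solutions (parallelization g) p \<noteq> {} \<Longrightarrow> a \<in> A \<Longrightarrow>
        \<exists>r\<in>solutions (parallelization g) p. H (bpair p a) = Some r" by blast
    have "computable_fun (\<lambda>r. Some (bpair (bfst r) (component (bsnd r) 0)))"
      using computable_fun_bpair[OF computable_fun_bfst
          computable_fun_compose[OF computable_fun_bsnd computable_fun_component_0]] by simp
    from computable_fun_compose[OF this H]
    show "g \<le>\<^sub>P\<^sub>W constant_problem A"
      unfolding char using computable_fun_id red
      by (intro exI[of _ "\<lambda>r. H (bpair (bfst r) (component (bsnd r) 0))"] exI[of _ Some])
        (simp add: sequences_def)
  qed
qed

lemma constant_problem_le_constant_problem_iff:
  "(constant_problem A :: 'a problem) \<le>\<^sub>P\<^sub>W constant_problem B \<longleftrightarrow> A \<le>\<^sub>M B"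
proof (cases "B = {}")
  case True
  then show ?thesis
    using parallel_weihrauch_le_Void medvedev_le_superset[of B A] by auto
next
  case False
  then have "sequences B \<noteq> {}" using repeat_in_sequences by blast
  with False have "(constant_problem A :: 'a problem) \<le>\<^sub>P\<^sub>W constant_problem B \<longleftrightarrow> A \<le>\<^sub>M sequences B"
    using computable_seq_zero
    by (auto simp: constant_problem_le_iff[OF named_values_constant_problem])
  also have "\<dots> \<longleftrightarrow> A \<le>\<^sub>M B"
    using medvedev_le_sequences sequences_medvedev_le medvedev_le_trans by blast
  finally show ?thesis .
qed

text \<open>
  Parallelization is essential here: a single query to \<open>g\<close> need not serve both reductions, but
  the two instance sequences can be merged into one. Its solution set is then an upper bound of both
  sets, to which the leastness of \<open>C\<close> applies directly.
\<close>

lemma constant_problem_lub: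
  assumes g: "named_values g" and "constant_problem A \<le>\<^sub>P\<^sub>W g" and "constant_problem B \<le>\<^sub>P\<^sub>W g"
    and least: "\<And>S. A \<le>\<^sub>M S \<Longrightarrow> B \<le>\<^sub>M S \<Longrightarrow> C \<le>\<^sub>M S"
  shows "constant_problem C \<le>\<^sub>P\<^sub>W g"
proof (cases "g = Void")
  case True
  then show ?thesis by (simp add: parallel_weihrauch_le_Void)
next
  case False
  let ?S = "solutions (parallelization g)"
  obtain k where k: "computable_seq k" "?S k \<noteq> {}" "A \<le>\<^sub>M ?S k"
    using assms(2) constant_problem_le_iff[OF g False] by blast
  obtain l where l: "computable_seq l" "?S l \<noteq> {}" "B \<le>\<^sub>M ?S l"
    using assms(3) constant_problem_le_iff[OF g False] by blast
  have merged: "?S (merge k l) = {r. even_components r \<in> ?S k \<and> odd_components r \<in> ?S l}"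
  proof -
    have "(\<forall>i. P i) \<longleftrightarrow> (\<forall>i. P (2 * i)) \<and> (\<forall>i. P (Suc (2 * i)))" for P :: "nat \<Rightarrow> bool"
    proof (intro iffI conjI allI)
      fix i assume "(\<forall>i. P (2 * i)) \<and> (\<forall>i. P (Suc (2 * i)))"
      then show "P i" by (cases "even i") (auto elim!: evenE oddE)
    qed simp_all
    then have "r \<in> ?S (merge k l) \<longleftrightarrow>
        (\<forall>i. component r (2 * i) \<in> solutions g (component (merge k l) (2 * i))) \<and>
        (\<forall>i. component r (Suc (2 * i)) \<in> solutions g (component (merge k l) (Suc (2 * i))))" for r
      unfolding solutions_parallelization mem_Collect_eq .
    moreover have "component (merge k l) (2 * i) = component k i"
      "component (merge k l) (Suc (2 * i)) = component l i" for i
      by (simp_all add: merge_def)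
    ultimately show ?thesis
      by (auto simp: solutions_parallelization even_components_def odd_components_def)
  qed
  have "?S k \<le>\<^sub>M ?S (merge k l)"
    by (rule medvedev_le_total[OF computable_fun_even_components]) (simp add: merged)
  moreover have "?S l \<le>\<^sub>M ?S (merge k l)"
    by (rule medvedev_le_total[OF computable_fun_odd_components]) (simp add: merged)
  ultimately have "C \<le>\<^sub>M ?S (merge k l)"
    using k(3) l(3) least medvedev_le_trans by blast
  moreover have "computable_seq (merge k l)" using k(1) l(1) by (rule computable_seq_merge)
  moreover have "?S (merge k l) \<noteq> {}"
  proof -
    obtain q r where qr: "q \<in> ?S k" "r \<in> ?S l" using k(2) l(2) by blast
    have "merge q r \<in> ?S (merge k l)"
      using qr by (simp add: solutions_parallelization merge_def)
    then show ?thesis by blast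
  qed
  ultimately show ?thesis using constant_problem_le_iff[OF g False] by blast
qed

text \<open>
  An element of the disjoint sum tells by its tag which of the two reductions to run. One tagged
  element is enough, since by \<open>le_constant_problem_iff\<close> the reductions need no more than one
  element of \<open>A\<close> or \<open>B\<close>. The case distinction has to be lazy, because the other
  reduction may diverge.
\<close>

lemma constant_problem_glb:
  fixes g :: "'a problem"
  assumes g: "named_values g" and "g \<le>\<^sub>P\<^sub>W constant_problem A" and "g \<le>\<^sub>P\<^sub>W constant_problem B"
    and greatest: "\<And>S. S \<le>\<^sub>M A \<Longrightarrow> S \<le>\<^sub>M B \<Longrightarrow> S \<le>\<^sub>M C"
  shows "g \<le>\<^sub>P\<^sub>W constant_problem C"
proof -
  have "g \<le>\<^sub>P\<^sub>W constant_problem (disjoint_sum A B)"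
  proof (cases "g = Void")
    case True
    with assms(2,3) have "A = {}" "B = {}"
      by (simp_all add: Void_parallel_weihrauch_le_iff named_values_constant_problem)
    then have "disjoint_sum A B = {}" by (simp add: disjoint_sum_def)
    with True show ?thesis by (simp add: parallel_weihrauch_le_Void constant_problem_def)
  next
    case False
    let ?S = "solutions (parallelization g)"
    obtain F where F: "computable_fun F"
      "\<forall>p. ?S p \<noteq> {} \<longrightarrow> (\<forall>a\<in>A. \<exists>r\<in>?S p. F (bpair p a) = Some r)"
      using iffD1[OF le_constant_problem_iff[OF g False] assms(2)] by (elim exE conjE)
    obtain G where G: "computable_fun G"
      "\<forall>p. ?S p \<noteq> {} \<longrightarrow> (\<forall>b\<in>B. \<exists>r\<in>?S p. G (bpair p b) = Some r)"
      using iffD1[OF le_constant_problem_iff[OF g False] assms(3)] by (elim exE conjE)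
    define untag where "untag s = bpair (bfst s) (bsnd (bsnd s))" for s
    have "computable_fun (\<lambda>s. Some (untag s))"
      using computable_fun_bpair[OF computable_fun_bfst
          computable_fun_compose[OF computable_fun_bsnd computable_fun_bsnd]]
      by (simp add: untag_def)
    note branches = computable_fun_compose[OF this F(1)] computable_fun_compose[OF this G(1)]
    define H where "H s = (if s 1 = 0 then F (untag s) else G (untag s))" for s
    have "computable_fun H" unfolding H_def by (rule computable_fun_case[OF branches])
    moreover have "\<exists>r\<in>?S p. H (bpair p c) = Some r" if "?S p \<noteq> {}" "c \<in> disjoint_sum A B" for p c
    proof -
      have "bpair p c 1 = c 0" by (simp add: bpair_def)
      then have "H (bpair p c) = (if c 0 = 0 then F (bpair p (bsnd c)) else G (bpair p (bsnd c)))"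
        by (simp add: H_def untag_def)
      then show ?thesis using that F(2) G(2) by (simp add: disjoint_sum_def split: if_splits)
    qed
    ultimately show ?thesis
      by (intro iffD2[OF le_constant_problem_iff[OF g False]] exI[of _ H]) simp
  qed
  moreover have "constant_problem (disjoint_sum A B) \<le>\<^sub>P\<^sub>W (constant_problem C :: 'a problem)"
    using greatest disjoint_sum_medvedev_le
    by (simp add: constant_problem_le_constant_problem_iff)
  ultimately show ?thesis by (rule parallel_weihrauch_le_trans)
qed

section \<open>Degrees\<close>

text \<open>
  Both lattices are instances of one construction, the quotient of a preorder on a set by its
  equivalence. It allows bounds of degrees to be computed with representatives.
\<close>

definition degree_equiv :: "'b set \<Rightarrow> ('b \<Rightarrow> 'b \<Rightarrow> bool) \<Rightarrow> ('b \<times> 'b) set" where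
  "degree_equiv P r = {(x, y). x \<in> P \<and> y \<in> P \<and> r x y \<and> r y x}"

definition degree_order :: "'b set \<Rightarrow> ('b \<Rightarrow> 'b \<Rightarrow> bool) \<Rightarrow> 'b set gorder" where
  "degree_order P r = \<lparr>carrier = P // degree_equiv P r, eq = (=),
    le = (\<lambda>a b. \<exists>x\<in>a. \<exists>y\<in>b. r x y)\<rparr>"

definition degree_of :: "'b set \<Rightarrow> ('b \<Rightarrow> 'b \<Rightarrow> bool) \<Rightarrow> 'b \<Rightarrow> 'b set" where
  "degree_of P r x = degree_equiv P r `` {x}"

locale degrees =
  fixes P :: "'b set" and r :: "'b \<Rightarrow> 'b \<Rightarrow> bool"
  assumes refl: "r x x" and trans: "r x y \<Longrightarrow> r y z \<Longrightarrow> r x z"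
begin

abbreviation degree :: "'b \<Rightarrow> 'b set" where
  "degree x \<equiv> degree_of P r x"

lemma degree_iff: "x \<in> P \<Longrightarrow> y \<in> degree x \<longleftrightarrow> y \<in> P \<and> r x y \<and> r y x"
  by (simp add: degree_of_def degree_equiv_def)

lemma degree_eq:
  assumes "r x y" "r y x" "x \<in> P" "y \<in> P"
  shows "degree x = degree y"
  using assms by (auto simp: degree_iff intro: trans)

lemma carrier_iff: "a \<in> carrier (degree_order P r) \<longleftrightarrow> (\<exists>x\<in>P. a = degree x)"
  by (auto simp: degree_order_def degree_of_def quotient_def)

lemma degree_le_iff:
  assumes "x \<in> P" and "y \<in> P"
  shows "degree x \<sqsubseteq>\<^bsub>degree_order P r\<^esub> degree y \<longleftrightarrow> r x y"
proof -
  have "degree x \<sqsubseteq>\<^bsub>degree_order P r\<^esub> degree y \<longleftrightarrow> (\<exists>x'\<in>degree x. \<exists>y'\<in>degree y. r x' y')"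
    by (simp add: degree_order_def)
  also have "\<dots> \<longleftrightarrow> r x y"
  proof
    assume "\<exists>x'\<in>degree x. \<exists>y'\<in>degree y. r x' y'"
    then obtain x' y' where "r x x'" and "r x' y'" and "r y' y"
      using assms by (auto simp: degree_iff)
    then show "r x y" by (meson trans)
  next
    have "x \<in> degree x" "y \<in> degree y" using assms refl by (simp_all add: degree_iff)
    then show "\<exists>x'\<in>degree x. \<exists>y'\<in>degree y. r x' y'" if "r x y" using that by blast
  qed
  finally show ?thesis .
qed

lemma is_lub_degree_iff:
  assumes "x \<in> P" "y \<in> P" "z \<in> P"
  shows "is_lub (degree_order P r) (degree z) {degree x, degree y} \<longleftrightarrow>
    r x z \<and> r y z \<and> (\<forall>u\<in>P. r x u \<longrightarrow> r y u \<longrightarrow> r z u)"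
proof -
  let ?L = "degree_order P r"
  have carrier: "carrier ?L = degree ` P" using carrier_iff by blast
  then have "{degree x, degree y} \<inter> carrier ?L = {degree x, degree y}" using assms by blast
  then have upper: "Upper ?L {degree x, degree y} = degree ` {u \<in> P. r x u \<and> r y u}"
    unfolding Upper_def carrier using assms by (auto simp: degree_le_iff)
  have mem: "degree z \<in> degree ` {u \<in> P. r x u \<and> r y u} \<longleftrightarrow> r x z \<and> r y z"
  proof
    assume "degree z \<in> degree ` {u \<in> P. r x u \<and> r y u}"
    then obtain w where w: "degree z = degree w" "w \<in> P" "r x w" "r y w" by blast
    then have "degree x \<sqsubseteq>\<^bsub>?L\<^esub> degree z" "degree y \<sqsubseteq>\<^bsub>?L\<^esub> degree z"
      unfolding w(1) using assms by (simp_all add: degree_le_iff)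
    with assms show "r x z \<and> r y z" by (simp add: degree_le_iff)
  qed (use assms in blast)
  show ?thesis
    unfolding least_def upper carrier mem using assms by (auto simp: degree_le_iff)
qed

lemma is_glb_degree_iff:
  assumes "x \<in> P" "y \<in> P" "z \<in> P"
  shows "is_glb (degree_order P r) (degree z) {degree x, degree y} \<longleftrightarrow>
    r z x \<and> r z y \<and> (\<forall>u\<in>P. r u x \<longrightarrow> r u y \<longrightarrow> r u z)"
proof -
  let ?L = "degree_order P r"
  have carrier: "carrier ?L = degree ` P" using carrier_iff by blast
  then have "{degree x, degree y} \<inter> carrier ?L = {degree x, degree y}" using assms by blast
  then have lower: "Lower ?L {degree x, degree y} = degree ` {u \<in> P. r u x \<and> r u y}"
    unfolding Lower_def carrier using assms by (auto simp: degree_le_iff)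
  have mem: "degree z \<in> degree ` {u \<in> P. r u x \<and> r u y} \<longleftrightarrow> r z x \<and> r z y"
  proof
    assume "degree z \<in> degree ` {u \<in> P. r u x \<and> r u y}"
    then obtain w where w: "degree z = degree w" "w \<in> P" "r w x" "r w y" by blast
    then have "degree z \<sqsubseteq>\<^bsub>?L\<^esub> degree x" "degree z \<sqsubseteq>\<^bsub>?L\<^esub> degree y"
      unfolding w(1) using assms by (simp_all add: degree_le_iff)
    with assms show "r z x \<and> r z y" by (simp add: degree_le_iff)
  qed (use assms in blast)
  show ?thesis
    unfolding greatest_def lower carrier mem using assms by (auto simp: degree_le_iff)
qed

end

interpretation medvedev: degrees UNIV medvedev_le
  by unfold_locales (rule medvedev_le_superset[OF order_refl], rule medvedev_le_trans)

interpretation weihrauch: degrees "problems R" parallel_weihrauch_le for R :: "'a rep_space set"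
  by unfold_locales (rule parallel_weihrauch_le_refl, rule parallel_weihrauch_le_trans)

lemma medvedev_lattice_eq: "medvedev_lattice = degree_order UNIV medvedev_le"
  by (simp add: medvedev_lattice_def degree_order_def degree_equiv_def medvedev_equiv_def)

lemma parallel_weihrauch_lattice_eq:
  "parallel_weihrauch_lattice R = degree_order (problems R) parallel_weihrauch_le"
  by (simp add: parallel_weihrauch_lattice_def degree_order_def degree_equiv_def
      parallel_weihrauch_equiv_def)

lemma parallel_degree_eq:
  "parallel_degree R f = degree_of (problems R) parallel_weihrauch_le f"
  by (simp add: degree_of_def parallel_degree_def degree_equiv_def parallel_weihrauch_equiv_def)

lemma named_values_problems: "g \<in> problems R \<Longrightarrow> named_values g"
  by (auto simp: problems_def multifun_def)

text \<open>
  A constant function with value in \<open>A\<close> is a continuous realizer.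
\<close>

lemma constant_problem_total_continuous:
  assumes "A \<noteq> {}"
  obtains f where "(constant_problem A :: 'a problem) = MultiFun baire_space baire_space f"
    and "multifun baire_space baire_space f" and "total_multifun baire_space f"
    and "continuous_multifun baire_space baire_space f"
proof -
  define f :: "'a point \<Rightarrow> 'a point set" where
    "f = (\<lambda>x. {y. x \<in> ran baire_space \<and> (\<exists>q\<in>A. baire_space q = Some y)})"
  obtain a where a: "a \<in> A" using assms by blast
  obtain y :: "'a point" where y: "baire_space a = Some y" by (simp add: baire_space_def)
  have y_value: "y \<in> f x" if "x \<in> ran baire_space" for x
    using that a y by (auto simp: f_def)
  show thesis
  proof (rule that)
    show "constant_problem A = MultiFun baire_space baire_space f"
      using assms by (simp add: constant_problem_def f_def)
    show "multifun baire_space baire_space f"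
      by (auto simp: multifun_def f_def ran_def)
    show "total_multifun baire_space f"
      using y_value by (fastforce simp: total_multifun_def mdom_def f_def)
    have "realizer baire_space baire_space f (\<lambda>_. Some a)"
      using y_value y by (auto simp: realizer_def ran_baire_space)
    then show "continuous_multifun baire_space baire_space f"
      unfolding continuous_multifun_def by (auto intro!: exI[of _ "\<lambda>_. Some a"])
  qed
qed

lemma constant_problem_in_problems:
  assumes "admissible R"
  shows "constant_problem A \<in> problems R"
proof (cases "A = {}")
  case False
  then obtain f where f: "(constant_problem A :: 'a problem) = MultiFun baire_space baire_space f"
    and "multifun baire_space baire_space f" and total: "total_multifun baire_space f"
    by (rule constant_problem_total_continuous)
  moreover obtain x :: "'a point" where x: "baire_space (\<lambda>_. 0) = Some x"
    by (simp add: baire_space_def)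
  then have "x \<in> mdom f" "computable_point baire_space x"
    using total computable_seq_zero ran_baire_space
    by (auto simp: total_multifun_def computable_point_def)
  moreover have "baire_space \<in> R" using assms by (simp add: admissible_def)
  ultimately show ?thesis unfolding problems_def by blast
qed (simp add: constant_problem_def problems_def)

theorem corollary5p4:
  fixes R :: "'a rep_space set"
  assumes "admissible R"
  shows "\<exists>\<iota> :: baire set set \<Rightarrow> 'a problem set.
    (\<forall>a\<in>carrier medvedev_lattice. \<iota> a \<in> carrier (parallel_weihrauch_lattice R)) \<and>
    (\<forall>a\<in>carrier medvedev_lattice. \<forall>b\<in>carrier medvedev_lattice.
      a \<sqsubseteq>\<^bsub>medvedev_lattice\<^esub> b \<longleftrightarrow> \<iota> a \<sqsubseteq>\<^bsub>parallel_weihrauch_lattice R\<^esub> \<iota> b) \<and>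
    (\<forall>a\<in>carrier medvedev_lattice.
      \<iota> a = parallel_degree R Void \<or>
      (\<exists>f. multifun baire_space baire_space f \<and> total_multifun baire_space f \<and>
        continuous_multifun baire_space baire_space f \<and>
        \<iota> a = parallel_degree R (MultiFun baire_space baire_space f))) \<and>
    (\<forall>a\<in>carrier medvedev_lattice. \<forall>b\<in>carrier medvedev_lattice. \<forall>c.
      is_lub medvedev_lattice c {a, b} \<longrightarrow>
      is_lub (parallel_weihrauch_lattice R) (\<iota> c) {\<iota> a, \<iota> b}) \<and>
    (\<forall>a\<in>carrier medvedev_lattice. \<forall>b\<in>carrier medvedev_lattice. \<forall>c.
      is_glb medvedev_lattice c {a, b} \<longrightarrow>
      is_glb (parallel_weihrauch_lattice R) (\<iota> c) {\<iota> a, \<iota> b})"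
proof -
  define j :: "baire set \<Rightarrow> 'a problem" where "j = constant_problem"
  note in_problems = constant_problem_in_problems[OF assms, folded j_def]
  note le_iff = constant_problem_le_constant_problem_iff[where 'a = 'a, folded j_def]
  \<comment> \<open>Equivalent sets have equivalent constant problems, so the choice of a representative does not
    affect the degree.\<close>
  define \<iota> where "\<iota> a = parallel_degree R (j (SOME A. A \<in> a))" for a :: "baire set set"
  have \<iota>: "\<iota> (medvedev.degree A) = weihrauch.degree R (j A)" for A
  proof -
    have "A \<in> medvedev.degree A" by (simp add: medvedev.degree_iff medvedev.refl)
    then have "(SOME B. B \<in> medvedev.degree A) \<in> medvedev.degree A" by (rule someI)
    then have "weihrauch.degree R (j (SOME B. B \<in> medvedev.degree A)) = weihrauch.degree R (j A)"
      by (intro weihrauch.degree_eq) (simp_all add: medvedev.degree_iff le_iff in_problems)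
    then show ?thesis by (simp add: \<iota>_def parallel_degree_eq)
  qed
  have med: "\<exists>A. a = medvedev.degree A" if "a \<in> carrier medvedev_lattice" for a
    using that by (simp add: medvedev_lattice_eq medvedev.carrier_iff)
  show ?thesis
  proof (intro exI[of _ \<iota>] conjI ballI allI impI)
    fix a assume "a \<in> carrier medvedev_lattice"
    then obtain A where a: "a = medvedev.degree A" using med by blast
    show "\<iota> a \<in> carrier (parallel_weihrauch_lattice R)"
      using in_problems by (auto simp: a \<iota> parallel_weihrauch_lattice_eq weihrauch.carrier_iff)
    show "\<iota> a = parallel_degree R Void \<or>
      (\<exists>f. multifun baire_space baire_space f \<and> total_multifun baire_space f \<and>
        continuous_multifun baire_space baire_space f \<and>
        \<iota> a = parallel_degree R (MultiFun baire_space baire_space f))"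
    proof (cases "A = {}")
      case True
      then show ?thesis by (simp add: a \<iota> parallel_degree_eq j_def constant_problem_def)
    next
      case False
      then obtain f where "(j A :: 'a problem) = MultiFun baire_space baire_space f"
        and "multifun baire_space baire_space f" and "total_multifun baire_space f"
        and "continuous_multifun baire_space baire_space f"
        unfolding j_def by (rule constant_problem_total_continuous)
      then show ?thesis unfolding a \<iota> parallel_degree_eq by (intro disjI2 exI[of _ f]) simp
    qed
  next
    fix a b assume carrier: "a \<in> carrier medvedev_lattice" "b \<in> carrier medvedev_lattice"
    obtain A where a: "a = medvedev.degree A" using med[OF carrier(1)] by (elim exE)
    obtain B where b: "b = medvedev.degree B" using med[OF carrier(2)] by (elim exE)
    show "a \<sqsubseteq>\<^bsub>medvedev_lattice\<^esub> b \<longleftrightarrow> \<iota> a \<sqsubseteq>\<^bsub>parallel_weihrauch_lattice R\<^esub> \<iota> b"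
      unfolding a b \<iota> medvedev_lattice_eq parallel_weihrauch_lattice_eq
      by (simp add: medvedev.degree_le_iff weihrauch.degree_le_iff in_problems le_iff)
    fix c
    {
      assume lub: "is_lub medvedev_lattice c {a, b}"
      then have "c \<in> carrier medvedev_lattice" by (simp add: least_def Upper_def)
      from med[OF this] obtain C where c: "c = medvedev.degree C" by (elim exE)
      have C: "A \<le>\<^sub>M C \<and> B \<le>\<^sub>M C \<and> (\<forall>S. A \<le>\<^sub>M S \<longrightarrow> B \<le>\<^sub>M S \<longrightarrow> C \<le>\<^sub>M S)"
        using lub by (simp add: a b c medvedev_lattice_eq medvedev.is_lub_degree_iff)
      have "j C \<le>\<^sub>P\<^sub>W u" if "u \<in> problems R" "j A \<le>\<^sub>P\<^sub>W u" "j B \<le>\<^sub>P\<^sub>W u" for u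
        using constant_problem_lub[OF named_values_problems[OF that(1)]
            that(2,3)[unfolded j_def], of C] C
        by (simp add: j_def)
      then show "is_lub (parallel_weihrauch_lattice R) (\<iota> c) {\<iota> a, \<iota> b}"
        unfolding a b c \<iota> parallel_weihrauch_lattice_eq
          weihrauch.is_lub_degree_iff[OF in_problems in_problems in_problems]
        using C by (simp add: le_iff)
    next
      assume glb: "is_glb medvedev_lattice c {a, b}"
      then have "c \<in> carrier medvedev_lattice" by (simp add: greatest_def Lower_def)
      from med[OF this] obtain C where c: "c = medvedev.degree C" by (elim exE)
      have C: "C \<le>\<^sub>M A \<and> C \<le>\<^sub>M B \<and> (\<forall>S. S \<le>\<^sub>M A \<longrightarrow> S \<le>\<^sub>M B \<longrightarrow> S \<le>\<^sub>M C)"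
        using glb by (simp add: a b c medvedev_lattice_eq medvedev.is_glb_degree_iff)
      have "u \<le>\<^sub>P\<^sub>W j C" if "u \<in> problems R" "u \<le>\<^sub>P\<^sub>W j A" "u \<le>\<^sub>P\<^sub>W j B" for u
        using constant_problem_glb[OF named_values_problems[OF that(1)]
            that(2,3)[unfolded j_def], of C] C
        by (simp add: j_def)
      then show "is_glb (parallel_weihrauch_lattice R) (\<iota> c) {\<iota> a, \<iota> b}"
        unfolding a b c \<iota> parallel_weihrauch_lattice_eq
          weihrauch.is_glb_degree_iff[OF in_problems in_problems in_problems]
        using C by (simp add: le_iff)
    }
  qed
qed

end
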